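(* There is no singularity of a real algebraic curve in the plane consisting of exactly five branches $A,B,C,D,E$ such that the cyclic word read along a small circle centred at the singular point is $$A\,E\,B\,A\,C\,B\,D\,C\,E\,D .$$ In other words, there do not exist a nonzero real polynomial $F(x,y)$ and a point $p\in\mathbb{R}^2$ with $F(p)=0$ such that the germ at $p$ of the curve $\{F=0\}\subset\mathbb{R}^2$ has exactly five real branches which, suitably named $A,B,C,D,E$, meet all sufficiently small circles centred at $p$ in ten points whose cyclic order, labelled by the branches to which they belong, is the cyclic word above.
   Context: Let $F$ be a nonzero real polynomial (or, more generally, a nonzero real analytic function near $p$) with $F(p)=0$. In a neighbourhood of $p$, the real zero set of $F$ is either $\{p\}$ or the union of finitely many real branches. A real branch is the image of an injective real analytic map $\gamma:(-\varepsilon,\varepsilon)\to\mathbb{R}^2$ with $\gamma(0)=p$. Distinct branches meet only at $p$, and every branch meets each sufficiently small circle centred at $p$ in exactly two points (one for $t>0$ and one for $t<0$). Reading the names of the branches along a small circle gives a cyclic word in which each letter occurs exactly twice; it does not depend on the small radius. *)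

theory Defs
  imports "HOL-Analysis.Analysis" "HOL-Computational_Algebra.Polynomial"
begin

(* A real polynomial in x and y is an element of R[x][y]: the coefficients of the outer
   polynomial are polynomials in x, and the outer variable is y. *)
definition eval2 :: "real poly poly \<Rightarrow> real \<times> real \<Rightarrow> real" where
  "eval2 F z = poly (poly F [:snd z:]) (fst z)"

definition zero_set :: "real poly poly \<Rightarrow> (real \<times> real) set" where
  "zero_set F = {z. eval2 F z = 0}"

definition real_analytic_on :: "(real \<Rightarrow> 'a::real_normed_vector) \<Rightarrow> real set \<Rightarrow> bool" where
  "real_analytic_on \<gamma> S \<longleftrightarrow>
     (\<forall>t0\<in>S. \<exists>a :: nat \<Rightarrow> 'a. \<forall>\<^sub>F t in nhds t0. (\<lambda>n. (t - t0) ^ n *\<^sub>R a n) sums \<gamma> t)"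

definition real_branch :: "real \<times> real \<Rightarrow> (real \<times> real) set \<Rightarrow> bool" where
  "real_branch p S \<longleftrightarrow>
     (\<exists>(\<gamma> :: real \<Rightarrow> real \<times> real) \<epsilon>. 0 < \<epsilon> \<and> real_analytic_on \<gamma> {-\<epsilon><..<\<epsilon>} \<and>
        inj_on \<gamma> {-\<epsilon><..<\<epsilon>} \<and> \<gamma> 0 = p \<and> S = \<gamma> ` {-\<epsilon><..<\<epsilon>})"

(* The germ of Z at p has exactly the branches \<Gamma> i, one for each i of the index type.
   The last condition says that \<Gamma> i is small enough to represent a germ at p: it excludes an
   injective arc that comes back towards p as its parameter tends to an end of the interval.
   It holds for every branch once the interval of its parameter is small enough. *)
definition germ_branches ::
    "(real \<times> real) set \<Rightarrow> real \<times> real \<Rightarrow> ('i \<Rightarrow> (real \<times> real) set) \<Rightarrow> bool" where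
  "germ_branches Z p \<Gamma> \<longleftrightarrow>
     (\<forall>i. real_branch p (\<Gamma> i)) \<and>
     (\<exists>U. open U \<and> p \<in> U \<and> Z \<inter> U = (\<Union>i. \<Gamma> i) \<inter> U \<and>
          (\<forall>i j. i \<noteq> j \<longrightarrow> \<Gamma> i \<inter> \<Gamma> j \<inter> U = {p})) \<and>
     (\<forall>i. \<forall>\<^sub>F r in at_right 0. card (\<Gamma> i \<inter> sphere p r) = 2)"

(* Going once counterclockwise around the circle of radius r, from some starting point, one meets
   the branches in length w points, the k-th of which lies on the branch w ! k and on no other.
   The start is arbitrary, so w counts only up to rotation. *)
definition reads_cyclic_word ::
    "('i \<Rightarrow> (real \<times> real) set) \<Rightarrow> real \<times> real \<Rightarrow> real \<Rightarrow> 'i list \<Rightarrow> bool" where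
  "reads_cyclic_word \<Gamma> p r w \<longleftrightarrow>
     (\<exists>\<theta> :: nat \<Rightarrow> real.
        strict_mono_on {..<length w} \<theta> \<and>
        (\<forall>k<length w. \<theta> k < \<theta> 0 + 2 * pi) \<and>
        (\<forall>i. \<Gamma> i \<inter> sphere p r =
              {p + r *\<^sub>R (cos (\<theta> k), sin (\<theta> k)) | k. k < length w \<and> w ! k = i}))"

datatype branch_name = A | B | C | D | E

end

theory Submission
  imports Defs "HOL-Complex_Analysis.Complex_Analysis"
begin

text \<open>
  On every cyclic word read from analytic branches, either some letter follows itself, or two letters
  are adjacent at two different places
  (\<open>analytic_word_repeats_adjacency\<close>). In A E B A C B D C E D each of the
  ten pairs of letters is adjacent exactly once, so this word does not occur.

  The reason lies in the Puiseux expansions. In polar coordinates a branch of multiplicity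
  \<open>m\<close> is \<open>p + s ^ m * (cos \<phi>, sin \<phi>)\<close> with \<open>\<phi>\<close> a power series in \<open>s\<close>
  (\<open>branch_polar_form\<close>), so each of its two ends has an angle that is a power series in a root of
  the radius, and the two series are conjugate: one arises from the other by sign changes of
  coefficients, together with a half turn if \<open>m\<close> is odd. The ends are ordered around the
  circle by the first coefficients in which they differ; call the index of this
  coefficient their contact.

  Choose two neighbouring ends \<open>p\<close>, \<open>q\<close> of maximal contact \<open>K\<close> and consider the other
  ends of their branches. If the multiplicities of the two branches are divisible by the same power of 2,
  conjugation acts in the same way on both series, and the other ends of the two branches have contact
  \<open>K\<close> too; nothing can lie between them, for otherwise conjugation would place an end between \<open>p\<close> and
  \<open>q\<close> (\<open>mates_adjacent\<close>). If the multiplicity of \<open>p\<close>'s branch is divisible by a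
  higher power of 2, then the first sign change in the series of \<open>p\<close> happens exactly at
  index \<open>K\<close>, where the coefficient of \<open>q\<close> vanishes; so \<open>q\<close> is flanked on both sides by
  the two ends of the other branch (\<open>mate_adjacent_to_neighbour\<close>). Either way the two letters are
  adjacent twice.
\<close>

section \<open>Order and conjugation of Puiseux expansions\<close>

lemma even_div_pow2:
  assumes "2 ^ e' dvd (n::nat)" "e < e'"
  shows "even (n div 2 ^ e)"
proof -
  obtain d where d: "e' = Suc (e + d)" using assms(2) less_imp_Suc_add by blast
  obtain q where "n = 2 ^ e' * q" using assms(1) by blast
  then have "n = 2 ^ e * (2 * 2 ^ d * q)" using d by (simp add: power_add)
  then show ?thesis by simp
qed

text \<open>
  The combinatorial content of the Puiseux expansions. An end is one of the two halves of a branch,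
  and a lifted end is an end with a choice of its angle among the values that differ by
  \<open>2 * pi\<close>. Lifted ends are numbered by the integers in the order of their angles;
  \<open>L\<close> ends make one turn. The angle of lifted end \<open>k\<close> is the power series with coefficients
  \<open>c k\<close> in a common root \<open>\<rho>\<close> of the radius, so the order is the lexicographic one on
  coefficients. A branch of multiplicity \<open>m i\<close> contributes a series in
  \<open>\<rho> ^ (M div m i)\<close>, where \<open>M\<close> is the product of all multiplicities. Passing to the other end of the
  branch changes the sign of \<open>\<rho> ^ (M div m i)\<close> and, if \<open>m i\<close> is odd, turns the direction by
  \<open>pi\<close>. Only the 2-adic valuation \<open>e i\<close> of \<open>M div m i\<close> matters for the signs, and
  \<open>e i = emax\<close> says that \<open>m i\<close> is odd. Counting the half turn upwards in both directions makes
  \<open>mate\<close> commute with full turns, at the price that it is not an involution: applied twice it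
  may add one turn.
\<close>
locale lifted_ends =
  fixes letter :: "int \<Rightarrow> 'i" and c :: "int \<Rightarrow> nat \<Rightarrow> real" and mate :: "int \<Rightarrow> int"
    and e :: "'i \<Rightarrow> nat" and emax :: nat and L :: int
  assumes lex: "k < l \<Longrightarrow> \<exists>n. (\<forall>j<n. c k j = c l j) \<and> c k n < c l n"
    and bounded_contact: "\<exists>b. \<forall>k n. (\<forall>j<n. c k j = c (k + 1) j) \<longrightarrow> n \<le> b"
    and letter_periodic: "L dvd k - l \<Longrightarrow> letter k = letter l"
    and letter_mate: "letter (mate k) = letter k"
    and mate_neq: "\<not> L dvd mate k - k"
    and surj_mate: "surj mate"
    and e_le: "e i \<le> emax"
    and support: "0 < n \<Longrightarrow> c k n \<noteq> 0 \<Longrightarrow> 2 ^ e (letter k) dvd n"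
    and mate_coeff: "0 < n \<Longrightarrow> c (mate k) n = (-1) ^ (n div 2 ^ e (letter k)) * c k n"
    and mate_coeff_0: "c (mate k) 0 = c k 0 + (if e (letter k) = emax then pi else 0)"
begin

definition precedes :: "nat \<Rightarrow> int \<Rightarrow> int \<Rightarrow> bool" where
  "precedes n k l \<longleftrightarrow> (\<forall>j<n. c k j = c l j) \<and> c k n < c l n"

lemma precedes_trans:
  assumes "precedes p k l" "precedes q l m"
  shows "precedes (min p q) k m"
proof -
  consider "p < q" | "p = q" | "q < p" by linarith
  then show ?thesis
    by cases (use assms in \<open>auto simp: precedes_def min_def\<close>)
qed

lemma precedes_unique:
  assumes "precedes p k l" "precedes q k l"
  shows "p = q"
  using assms unfolding precedes_def by (metis less_irrefl linorder_neqE_nat)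

lemma precedes_imp_less:
  assumes "precedes n k l"
  shows "k < l"
proof (rule ccontr)
  assume "\<not> k < l"
  then have "l = k \<or> l < k" by linarith
  then show False
  proof
    assume "l = k"
    then show False using assms by (simp add: precedes_def)
  next
    assume "l < k"
    then obtain p where "precedes p l k" using lex unfolding precedes_def by blast
    then have "precedes (min n p) k k" using precedes_trans[OF assms] by blast
    then show False by (simp add: precedes_def)
  qed
qed

context
  fixes K :: nat
  assumes K_max: "\<And>k n. precedes n k (k + 1) \<Longrightarrow> n \<le> K"
begin

text \<open>
  Contact is an ultrametric: two ends have the smallest of the contacts of the consecutive ends
  between them. So \<open>K\<close>, which bounds the contacts of consecutive ends, bounds all of them.
\<close>
lemma contact_le:
  assumes "precedes n k l"
  shows "n \<le> K"
proof (cases "l = k + 1")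
  case True
  then show ?thesis using assms K_max by blast
next
  case False
  then have "k < k + 1" "k + 1 < l" using precedes_imp_less[OF assms] by auto
  then obtain p q where pq: "precedes p k (k + 1)" "precedes q (k + 1) l"
    using lex unfolding precedes_def by meson
  then have "n = min p q" using precedes_trans precedes_unique assms by blast
  then show ?thesis using K_max[OF pq(1)] by simp
qed

lemma precedes_between:
  assumes "precedes K k l" "k < j" "j < l"
  shows "precedes K k j" "precedes K j l"
proof -
  obtain p q where pq: "precedes p k j" "precedes q j l"
    using lex assms(2,3) unfolding precedes_def by meson
  then have "K = min p q" using precedes_trans precedes_unique assms(1) by blast
  moreover have "p \<le> K" "q \<le> K" using pq contact_le by auto
  ultimately have "p = K" "q = K" by auto
  then show "precedes K k j" "precedes K j l" using pq by auto
qed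

text \<open>
  From here on two ends with contact \<open>K\<close> are compared by their coefficients of index \<open>K\<close>. The
  next two lemmas translate between these numbers and adjacency.
\<close>
lemma gap:
  assumes agree: "\<And>n. n < K \<Longrightarrow> c u n = c v n" and neq: "c u K \<noteq> c v K"
    and not_adj: "\<bar>u - v\<bar> \<noteq> 1"
  obtains j where "\<And>n. n < K \<Longrightarrow> c j n = c u n"
    "min (c u K) (c v K) < c j K" "c j K < max (c u K) (c v K)"
proof -
  have *: "\<exists>j. (\<forall>n<K. c j n = c u n) \<and> min (c u K) (c v K) < c j K \<and> c j K < max (c u K) (c v K)"
    if "precedes K x y" "{x, y} = {u, v}" for x y
  proof -
    have "x < y" using precedes_imp_less[OF that(1)] .
    moreover have "\<bar>x - y\<bar> \<noteq> 1" using that(2) not_adj by (auto simp: doubleton_eq_iff)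
    ultimately have "x < x + 1" "x + 1 < y" by auto
    note b = precedes_between[OF that(1) this]
    have "\<And>n. n < K \<Longrightarrow> c (x + 1) n = c u n" using b that(2) agree
      by (auto simp: precedes_def doubleton_eq_iff)
    moreover have "min (c u K) (c v K) < c (x + 1) K" "c (x + 1) K < max (c u K) (c v K)"
      using b that(2) by (auto simp: precedes_def doubleton_eq_iff)
    ultimately show ?thesis by blast
  qed
  have "\<exists>j. (\<forall>n<K. c j n = c u n) \<and> min (c u K) (c v K) < c j K \<and> c j K < max (c u K) (c v K)"
  proof (cases "c u K < c v K")
    case True
    then have "precedes K u v" using agree by (simp add: precedes_def)
    then show ?thesis using * by blast
  next
    case False
    then have "precedes K v u" using agree neq by (simp add: precedes_def)
    then show ?thesis using * by blast
  qed
  then show thesis using that by blast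
qed

lemma no_gap:
  assumes "\<And>n. n < K \<Longrightarrow> c j n = c u n" "\<And>n. n < K \<Longrightarrow> c j n = c v n" "\<bar>u - v\<bar> = 1"
    and "min (c u K) (c v K) < c j K" "c j K < max (c u K) (c v K)"
  shows False
proof (cases "c u K < c v K")
  case True
  then have "precedes K u j" "precedes K j v" using assms by (auto simp: precedes_def)
  then have "u < j" "j < v" using precedes_imp_less by auto
  then show False using assms(3) by linarith
next
  case False
  then have "precedes K v j" "precedes K j u" using assms by (auto simp: precedes_def)
  then have "v < j" "j < u" using precedes_imp_less by auto
  then show False using assms(3) by linarith
qed

text \<open>
  The contact of an end with its own mate is at most \<open>K\<close>; for even multiplicity it is the index
  of the first coefficient whose sign changes.
\<close>
lemma odd_term:
  assumes "e (letter j) < emax"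
  obtains n where "n \<le> K" "0 < n" "c j n \<noteq> 0" "2 ^ e (letter j) dvd n" "odd (n div 2 ^ e (letter j))"
proof -
  have "mate j \<noteq> j" using mate_neq[of j] by auto
  then have "mate j < j \<or> j < mate j" by linarith
  then obtain n where n: "precedes n (mate j) j \<or> precedes n j (mate j)"
    using lex unfolding precedes_def by meson
  then have "n \<le> K" using contact_le by blast
  have neq: "c (mate j) n \<noteq> c j n" using n by (auto simp: precedes_def)
  have "n > 0" using neq mate_coeff_0[of j] assms by (cases n) auto
  then have "odd (n div 2 ^ e (letter j))" "c j n \<noteq> 0"
    using neq mate_coeff[of n j] by auto
  then show thesis using that \<open>n \<le> K\<close> \<open>n > 0\<close> support by blast
qed

text \<open>
  If both branches have the same valuation, then passing to the other end acts in the same way on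
  both expansions, so the mates are again at contact \<open>K\<close>. An end strictly between the mates would
  produce an end between \<open>p\<close> and \<open>q\<close>: the end whose mate it is if it has the same valuation,
  and itself if its valuation is larger, since its coefficient of index \<open>K\<close> is then 0 and the
  change of sign exchanges the pair \<open>p\<close>, \<open>q\<close> with the pair of mates. A smaller valuation would force the two coefficients of index \<open>K\<close> to vanish.
\<close>
lemma mates_adjacent:
  assumes pq: "\<And>n. n < K \<Longrightarrow> c p n = c q n" "c p K \<noteq> c q K" "\<bar>p - q\<bar> = 1"
    and eq: "e (letter p) = e (letter q)"
  shows "\<bar>mate p - mate q\<bar> = 1"
proof (rule ccontr)
  assume not_adj: "\<bar>mate p - mate q\<bar> \<noteq> 1"
  define f where "f = e (letter p)"
  have ep: "e (letter p) = f" and eq': "e (letter q) = f" using eq f_def by auto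
  \<comment> \<open>On both branches, \<open>mate\<close> multiplies coefficient \<open>n\<close> by \<open>sg n\<close> and then adds \<open>sh n\<close>.\<close>
  define sg :: "nat \<Rightarrow> real" where "sg n = (if n = 0 then 1 else (-1) ^ (n div 2 ^ f))" for n
  define sh :: "nat \<Rightarrow> real" where "sh n = (if n = 0 \<and> f = emax then pi else 0)" for n
  have sg: "sg n = 1 \<or> sg n = -1" for n unfolding sg_def
    by (cases "even (n div 2 ^ f)") auto
  have mc: "c (mate k) n = sg n * c k n + sh n" if "e (letter k) = f" for k n
    using mate_coeff[of n k] mate_coeff_0[of k] that by (auto simp: sg_def sh_def)
  have neq: "c (mate p) K \<noteq> c (mate q) K"
    using pq(2) sg[of K] mc[OF ep] mc[OF eq'] by auto
  have ag: "c (mate p) n = c (mate q) n" if "n < K" for n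
    using mc[OF ep] mc[OF eq'] pq(1)[OF that] by simp
  obtain j where j: "\<And>n. n < K \<Longrightarrow> c j n = c (mate p) n"
      "min (c (mate p) K) (c (mate q) K) < c j K" "c j K < max (c (mate p) K) (c (mate q) K)"
    using gap[OF ag neq not_adj] by blast
  consider "e (letter j) = f" | "e (letter j) < f" | "f < e (letter j)" by linarith
  then show False
  proof cases
    case 1
    obtain i where i: "j = mate i" using surj_mate by blast
    then have ei: "e (letter i) = f" using 1 letter_mate by simp
    note mi = mc[OF ei, folded i]
    have "c i n = c p n" if "n < K" for n
      using j(1)[OF that] mi[of n] mc[OF ep, of n] sg[of n] by auto
    moreover have "min (c p K) (c q K) < c i K" "c i K < max (c p K) (c q K)"
      using j(2,3) mi[of K] mc[OF ep, of K] mc[OF eq', of K] sg[of K]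
      by (auto simp: min_def max_def split: if_splits)
    ultimately show False using no_gap[of i p q] pq by auto
  next
    case 2
    then have "e (letter j) < emax" using e_le[of "letter p"] ep by linarith
    then obtain n where n: "n \<le> K" "0 < n" "c j n \<noteq> 0" "odd (n div 2 ^ e (letter j))"
      using odd_term by metis
    have nd: "\<not> 2 ^ f dvd n" using n(4) 2 even_div_pow2 by blast
    then have "c (mate p) n = 0" "c (mate q) n = 0"
      using support[of n] letter_mate ep eq' n(2) by metis+
    moreover from this have "n = K" using j(1)[of n] n(1,3) by (cases "n < K") auto
    ultimately show False using neq by simp
  next
    case 3
    then have lt: "f < emax" using e_le[of "letter j"] by linarith
    have odd_K: "K > 0 \<and> odd (K div 2 ^ f) \<and> c j K = 0"
    proof -
      obtain n where n: "n \<le> K" "0 < n" "c (mate p) n \<noteq> 0" "odd (n div 2 ^ f)"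
        using odd_term[of "mate p"] lt letter_mate ep by metis
      have "\<not> 2 ^ e (letter j) dvd n" using n(4) 3 even_div_pow2 by blast
      then have "c j n = 0" using support n(2) by blast
      moreover from this have "n = K" using j(1)[of n] n(1,3) by (cases "n < K") auto
      ultimately show ?thesis using n by simp
    qed
    have "c j n = c p n" if "n < K" for n
    proof (cases "n = 0")
      case True
      then show ?thesis using j(1)[OF that] mc[OF ep, of n] lt by (simp add: sg_def sh_def)
    next
      case False
      show ?thesis
      proof (cases "c j n = 0")
        case True
        then show ?thesis using j(1)[OF that] mc[OF ep, of n] sg[of n] False by (auto simp: sh_def)
      next
        case nz: False
        then have "even (n div 2 ^ f)" using support[of n j] False 3 even_div_pow2 by blast
        then show ?thesis using j(1)[OF that] mc[OF ep, of n] False by (simp add: sg_def sh_def)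
      qed
    qed
    moreover have "min (c p K) (c q K) < c j K" "c j K < max (c p K) (c q K)"
      using j(2,3) mc[OF ep, of K] mc[OF eq', of K] odd_K
      by (auto simp: min_def max_def sg_def sh_def split: if_splits)
    ultimately show False using no_gap[of j p q] pq by auto
  qed
qed

text \<open>
  If the valuations differ, say that of \<open>p\<close> is smaller, then \<open>q\<close> has coefficient 0 at index
  \<open>K\<close>, and \<open>p\<close> and its mate have opposite coefficients there: \<open>q\<close> lies between the two ends of
  the other branch. Any end between \<open>q\<close> and the mate of \<open>p\<close> has the valuation of \<open>p\<close>,
  and the other end of its branch lies between \<open>p\<close> and \<open>q\<close>.
\<close>
lemma mate_adjacent_to_neighbour:
  assumes pq: "\<And>n. n < K \<Longrightarrow> c p n = c q n" "c p K \<noteq> c q K" "\<bar>p - q\<bar> = 1"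
    and less: "e (letter p) < e (letter q)"
  shows "\<bar>mate p - q\<bar> = 1"
proof (rule ccontr)
  assume not_adj: "\<bar>mate p - q\<bar> \<noteq> 1"
  define f where "f = e (letter p)"
  have fq: "f < e (letter q)" using less f_def by simp
  have lt: "f < emax" using fq e_le[of "letter q"] by linarith
  have K: "K > 0" "c p K \<noteq> 0" "2 ^ f dvd K" "odd (K div 2 ^ f)" "c q K = 0"
  proof -
    obtain n where n: "n \<le> K" "0 < n" "c p n \<noteq> 0" "2 ^ f dvd n" "odd (n div 2 ^ f)"
      using odd_term[of p] lt f_def by metis
    have "\<not> 2 ^ e (letter q) dvd n" using n(5) fq even_div_pow2 by blast
    then have q0: "c q n = 0" using support n(2) by blast
    then have "n = K" using pq(1)[of n] n(1,3) by (cases "n < K") auto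
    then show "K > 0" "c p K \<noteq> 0" "2 ^ f dvd K" "odd (K div 2 ^ f)" "c q K = 0"
      using n q0 by auto
  qed
  have low: "c (mate k) n = c k n" if "e (letter k) = f" "n < K" "c k n = c q n" for k n
  proof (cases "n = 0")
    case True
    then show ?thesis using mate_coeff_0[of k] that(1) lt by simp
  next
    case False
    show ?thesis
    proof (cases "c q n = 0")
      case True
      then show ?thesis using mate_coeff[of n k] False that(3) by simp
    next
      case nz: False
      then have "even (n div 2 ^ f)" using support[of n q] False fq even_div_pow2 by blast
      then show ?thesis using mate_coeff[of n k] False that(1) by simp
    qed
  qed
  have top: "c (mate k) K = - c k K" if "e (letter k) = f" for k
    using mate_coeff[of K k] K that by simp
  have ag: "c (mate p) n = c q n" if "n < K" for n
    using low[of p n] pq(1)[OF that] that f_def by simp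
  have neq: "c (mate p) K \<noteq> c q K" using top[of p] K f_def by simp
  obtain j where j: "\<And>n. n < K \<Longrightarrow> c j n = c (mate p) n"
      "min (c (mate p) K) (c q K) < c j K" "c j K < max (c (mate p) K) (c q K)"
    using gap[OF ag neq not_adj] by blast
  have jq: "c j n = c q n" if "n < K" for n using j(1) ag that by simp
  have jK: "c j K \<noteq> 0" using j(2,3) K(5) by auto
  have "2 ^ e (letter j) dvd K" using support K(1) jK by blast
  then have "\<not> f < e (letter j)" using even_div_pow2 K(4) by blast
  moreover have "\<not> e (letter j) < f"
  proof
    assume *: "e (letter j) < f"
    then obtain n where n: "n \<le> K" "0 < n" "c j n \<noteq> 0" "odd (n div 2 ^ e (letter j))"
      using odd_term[of j] lt by (metis less_trans)
    have "\<not> 2 ^ f dvd n" using n(4) * even_div_pow2 by blast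
    then have "n \<noteq> K" using K(3) by auto
    then have "c q n \<noteq> 0" using n jq[of n] by auto
    then have "2 ^ e (letter q) dvd n" using support n(2) by blast
    then show False using n(4) * fq even_div_pow2 less_trans by blast
  qed
  ultimately have ej: "e (letter j) = f" by linarith
  obtain i where i: "j = mate i" using surj_mate by blast
  then have ei: "e (letter i) = f" using ej letter_mate by simp
  have iq: "c i n = c q n" if "n < K" for n
  proof (cases "n = 0")
    case True
    then show ?thesis using mate_coeff_0[of i] i ei lt jq[OF that] by simp
  next
    case False
    have "\<bar>c i n\<bar> = \<bar>c j n\<bar>" using mate_coeff[of n i] False i by (simp add: abs_mult)
    show ?thesis
    proof (cases "c q n = 0")
      case True
      then show ?thesis using \<open>\<bar>c i n\<bar> = \<bar>c j n\<bar>\<close> jq[OF that] by simp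
    next
      case nz: False
      then have "even (n div 2 ^ f)" using support[of n q] False fq even_div_pow2 by blast
      then show ?thesis using mate_coeff[of n i] False ei i jq[OF that] by simp
    qed
  qed
  have "min (c p K) (c q K) < c i K" "c i K < max (c p K) (c q K)"
    using j(2,3) top[OF ei] top[of p] K(5) i f_def
    by (auto simp: min_def max_def split: if_splits)
  then show False using no_gap[of i p q] pq iq by auto
qed

end

text \<open>
  A consecutive pair of maximal contact comes with a second adjacency between the same two
  branches, given by the two lemmas on mates.
\<close>
theorem repeated_adjacency:
  assumes no_double: "\<And>k. letter k \<noteq> letter (k + 1)"
    and once: "\<And>k l. {letter k, letter (k + 1)} = {letter l, letter (l + 1)} \<Longrightarrow> L dvd k - l"
  shows False
proof -
  define contacts where "contacts = {n. \<exists>k. precedes n k (k + 1)}"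
  obtain b where "\<forall>k n. (\<forall>j<n. c k j = c (k + 1) j) \<longrightarrow> n \<le> b" using bounded_contact by blast
  then have "contacts \<subseteq> {..b}" by (auto simp: contacts_def precedes_def)
  then have fin: "finite contacts" using finite_subset by blast
  obtain n where "precedes n 0 (0 + 1)" using lex[of 0 1] unfolding precedes_def by auto
  then have "contacts \<noteq> {}" unfolding contacts_def by blast
  define K where "K = Max contacts"
  have "K \<in> contacts" using K_def fin \<open>contacts \<noteq> {}\<close> by simp
  then obtain k where k: "precedes K k (k + 1)" by (auto simp: contacts_def)
  have K_max: "n \<le> K" if "precedes n k (k + 1)" for n k
    using that fin by (auto simp: K_def contacts_def intro!: Max_ge)
  have nk: "letter k \<noteq> letter (k + 1)" using no_double .
  have ag: "c k n = c (k + 1) n" if "n < K" for n using k that by (simp add: precedes_def)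
  have ne: "c k K \<noteq> c (k + 1) K" using k by (simp add: precedes_def)
  have sep: "\<bar>mate p - v\<bar> \<noteq> 1"
    if pq: "{p, q} = {k, k + 1}" and v: "letter v = letter q" for p q v
  proof
    assume "\<bar>mate p - v\<bar> = 1"
    then have "v = mate p + 1 \<or> mate p = v + 1" by linarith
    then obtain l where l: "{mate p, v} = {l, l + 1}" by (metis insert_commute)
    then have "{letter l, letter (l + 1)} = {letter k, letter (k + 1)}"
      using pq v letter_mate[of p] by (auto simp: doubleton_eq_iff)
    then have dvd: "L dvd l - k" using once by blast
    then have per: "letter l = letter k" "letter (l + 1) = letter (k + 1)"
      using letter_periodic by auto
    have "mate p - p = l - k"
      using pq l per nk letter_mate[of p] by (auto simp: doubleton_eq_iff)
    then show False using dvd mate_neq[of p] by simp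
  qed
  consider "e (letter k) = e (letter (k + 1))" | "e (letter k) < e (letter (k + 1))"
    | "e (letter (k + 1)) < e (letter k)" by linarith
  then show False
  proof cases
    case 1
    have "\<bar>mate k - mate (k + 1)\<bar> = 1"
      by (rule mates_adjacent[OF K_max ag ne _ 1]) auto
    then show False using sep[of k "k + 1" "mate (k + 1)"] letter_mate by auto
  next
    case 2
    have "\<bar>mate k - (k + 1)\<bar> = 1"
      by (rule mate_adjacent_to_neighbour[OF K_max ag ne _ 2]) auto
    then show False using sep[of k "k + 1" "k + 1"] by auto
  next
    case 3
    have "\<bar>mate (k + 1) - k\<bar> = 1"
      by (rule mate_adjacent_to_neighbour[OF K_max ag[symmetric] ne[symmetric] _ 3]) auto
    then show False using sep[of "k + 1" k k] by auto
  qed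
qed

end

section \<open>Real branches in polar coordinates\<close>

abbreviation direction :: "real \<Rightarrow> real \<times> real" where
  "direction \<theta> \<equiv> (cos \<theta>, sin \<theta>)"

lemma analytic_arc_complexification:
  assumes "real_analytic_on \<gamma> {-\<epsilon><..<\<epsilon>}" "0 < \<epsilon>"
  obtains f R where "0 < R" "R \<le> \<epsilon>" "f holomorphic_on ball 0 R"
    "\<And>t. \<bar>t\<bar> < R \<Longrightarrow> \<gamma> t - \<gamma> 0 = (Re (f (of_real t)), Im (f (of_real t)))" "f 0 = 0"
proof -
  obtain a where "\<forall>\<^sub>F t in nhds 0. (\<lambda>n. (t - 0) ^ n *\<^sub>R a n) sums \<gamma> t"
    using assms unfolding real_analytic_on_def by fastforce
  then obtain r where "r > 0" and r: "\<And>t. \<bar>t\<bar> < r \<Longrightarrow> (\<lambda>n. t ^ n *\<^sub>R a n) sums \<gamma> t"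
    unfolding eventually_nhds_metric by (auto simp: dist_real_def)
  define b where "b n = Complex (fst (a n)) (snd (a n))" for n
  define R where "R = min r \<epsilon> / 2"
  have R: "R > 0" "R \<le> \<epsilon>" "R < r" using \<open>r > 0\<close> assms(2) by (auto simp: R_def)
  have series: "(\<lambda>n. b n * of_real t ^ n) sums Complex (fst (\<gamma> t)) (snd (\<gamma> t))" if "\<bar>t\<bar> < r" for t
  proof -
    have "(\<lambda>n. fst (t ^ n *\<^sub>R a n)) sums fst (\<gamma> t)" "(\<lambda>n. snd (t ^ n *\<^sub>R a n)) sums snd (\<gamma> t)"
      using bounded_linear.sums[OF bounded_linear_fst r[OF that]]
        bounded_linear.sums[OF bounded_linear_snd r[OF that]] by auto
    then show ?thesis
      by (auto simp: sums_complex_iff b_def mult.commute simp flip: of_real_power)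
  qed
  define f where "f z = (\<Sum>n. b n * z ^ n) - b 0" for z
  have summ: "summable (\<lambda>n. b n * z ^ n)" if "norm z < R" for z
    by (rule powser_inside[OF sums_summable[OF series[of R]]]) (use R that in auto)
  have "(\<lambda>z. \<Sum>n. b n * z ^ n) holomorphic_on ball 0 R"
    by (rule power_series_holomorphic[where a = b]) (use summ in \<open>auto simp: summable_sums\<close>)
  then have "f holomorphic_on ball 0 R" unfolding f_def by (intro holomorphic_intros)
  moreover have "f 0 = 0" by (simp add: f_def)
  moreover have "\<gamma> t - \<gamma> 0 = (Re (f (of_real t)), Im (f (of_real t)))" if "\<bar>t\<bar> < R" for t
  proof -
    have "f (of_real t) = Complex (fst (\<gamma> t)) (snd (\<gamma> t)) - b 0"
      using series[of t] that R by (simp add: f_def sums_iff)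
    moreover have "b 0 = Complex (fst (\<gamma> 0)) (snd (\<gamma> 0))"
      using series[of 0] \<open>r > 0\<close> by (simp add: sums_iff)
    ultimately show ?thesis by (simp add: prod_eq_iff)
  qed
  ultimately show thesis using that R by blast
qed

text \<open>
  Near its zero, \<open>f w = w ^ m * exp (l w)\<close> with \<open>l\<close> holomorphic. On the real axis the modulus
  of \<open>f\<close> is \<open>\<bar>h w\<bar> ^ m\<close> with \<open>h w = w * exp (Re (l w) / m)\<close>. Extended holomorphically, \<open>h\<close> is
  invertible at 0, and its inverse is the parameter change \<open>g\<close> after which the modulus is
  \<open>\<bar>s\<bar> ^ m\<close>; the argument is then a power series in \<open>s\<close>.
\<close>
lemma holomorphic_polar_reparametrization:
  assumes holf: "f holomorphic_on ball 0 R" and "0 < R" "f 0 = 0"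
    and nonconst: "\<not> f constant_on ball 0 R"
  obtains m \<delta> g and a :: "nat \<Rightarrow> real" where "0 < m" "0 < \<delta>"
    "\<And>s. \<bar>s\<bar> < \<delta> \<Longrightarrow> \<bar>g s\<bar> < R"
    "inj_on g {-\<delta><..<\<delta>}"
    "\<And>s. \<bar>s\<bar> < \<delta> \<Longrightarrow> summable (\<lambda>n. a n * s ^ n)"
    "\<And>s. \<bar>s\<bar> < \<delta> \<Longrightarrow> f (of_real (g s)) = of_real (s ^ m) * cis (\<Sum>n. a n * s ^ n)"
proof -
  have zero: "0 \<in> ball (0::complex) R" using \<open>0 < R\<close> by simp
  obtain q r m where m: "0 < m" and r: "0 < r" "ball (0::complex) r \<subseteq> ball 0 R"
    and holq: "q holomorphic_on ball 0 r"
    and fq: "\<And>w. w \<in> ball 0 r \<Longrightarrow> f w = (w - 0) ^ m * q w"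
    and q0: "\<And>w. w \<in> ball 0 r \<Longrightarrow> q w \<noteq> 0"
    by (rule holomorphic_factor_zero_nonconstant[OF holf open_ball connected_ball zero \<open>f 0 = 0\<close> nonconst])
      (rule that)
  have zero_r: "0 \<in> ball (0::complex) r" using r by simp
  obtain l where holl: "l holomorphic_on ball 0 r" and l: "\<And>w. w \<in> ball 0 r \<Longrightarrow> exp (l w) = q w"
    by (rule holomorphic_logarithm_exists[OF convex_ball open_ball holq q0 zero_r]) (assumption, blast)
  have cnj_ball: "cnj ` ball 0 d = ball 0 d" for d
    by (auto simp: image_cnj_conv_vimage_cnj)
  \<comment> \<open>\<open>mo\<close> and \<open>ph\<close> are the holomorphic functions that equal \<open>Re l\<close> and \<open>Im l\<close> on the real axis.\<close>
  define l' where "l' = cnj \<circ> l \<circ> cnj"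
  have holl': "l' holomorphic_on ball 0 r" unfolding l'_def
    by (rule holomorphic_on_compose_cnj_cnj) (use holl cnj_ball in auto)
  define mo where "mo w = (l w + l' w) / 2" for w
  define ph where "ph w = (l w - l' w) / (2 * \<i>)" for w
  have mo_real: "mo (of_real t) = of_real (Re (l (of_real t)))"
    and ph_real: "ph (of_real t) = of_real (Im (l (of_real t)))" for t
    by (auto simp: mo_def ph_def l'_def complex_eq_iff)
  have holmo: "mo holomorphic_on ball 0 r" and holph: "ph holomorphic_on ball 0 r"
    unfolding mo_def ph_def by (intro holomorphic_intros holl holl'; simp)+
  define h where "h w = w * exp (mo w / of_nat m)" for w
  have holh: "h holomorphic_on ball 0 r" unfolding h_def by (intro holomorphic_intros holmo) (use m in auto)
  have h_cnj: "h (cnj w) = cnj (h w)" for w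
    by (simp add: h_def mo_def l'_def exp_cnj add.commute)
  have "(h has_field_derivative exp (mo 0 / of_nat m)) (at 0)"
  proof -
    have "(mo has_field_derivative deriv mo 0) (at 0)"
      using holomorphic_derivI[OF holmo open_ball] r by simp
    then show ?thesis unfolding h_def
      by (auto intro!: derivative_eq_intros) (use m in auto)
  qed
  then have dnz: "deriv h 0 \<noteq> 0" using DERIV_imp_deriv by fastforce
  obtain r1 where r1: "r1 > 0" "ball (0::complex) r1 \<subseteq> ball 0 r" "open (h ` ball 0 r1)" "inj_on h (ball 0 r1)"
    by (rule has_complex_derivative_locally_invertible[OF holh zero_r open_ball dnz]) blast
  have holh1: "h holomorphic_on ball 0 r1" using holh r1 holomorphic_on_subset by blast
  obtain k where holk: "k holomorphic_on h ` ball 0 r1" and k: "\<And>z. z \<in> ball 0 r1 \<Longrightarrow> k (h z) = z"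
    by (rule holomorphic_has_inverse[OF holh1 open_ball r1(4)]) auto
  have "0 \<in> h ` ball 0 r1" using r1 by (force simp: h_def image_iff)
  then obtain \<delta> where \<delta>: "\<delta> > 0" "ball 0 \<delta> \<subseteq> h ` ball 0 r1"
    using r1(3) by (auto elim!: openE)
  have kin: "k s \<in> ball 0 r1" "h (k s) = s" if "s \<in> ball 0 \<delta>" for s
    using that \<delta>(2) k by auto
  \<comment> \<open>The inverse is real on the real axis because \<open>h\<close> commutes with conjugation and is injective.\<close>
  have kreal: "k (of_real s) = of_real (Re (k (of_real s)))" if "\<bar>s\<bar> < \<delta>" for s
  proof -
    have s: "of_real s \<in> ball (0::complex) \<delta>" using that by simp
    have "h (cnj (k (of_real s))) = h (k (of_real s))" using kin[OF s] by (simp add: h_cnj)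
    moreover have "cnj (k (of_real s)) \<in> ball 0 r1" using kin[OF s] by simp
    ultimately have "cnj (k (of_real s)) = k (of_real s)" using r1(4) kin(1)[OF s] by (metis inj_onD)
    then show ?thesis by (metis Reals_cnj_iff of_real_Re)
  qed
  define g where "g s = Re (k (of_real s))" for s
  define \<psi> where "\<psi> = ph \<circ> k"
  have hol\<psi>: "\<psi> holomorphic_on ball 0 \<delta>" unfolding \<psi>_def
    by (rule holomorphic_on_compose_gen[OF _ holph])
      (use holk \<delta> kin r1 in \<open>auto intro: holomorphic_on_subset\<close>)
  define a where "a n = Re ((deriv ^^ n) \<psi> 0 / fact n)" for n
  have ser: "(\<lambda>n. a n * s ^ n) sums Im (l (of_real (g s)))" if "\<bar>s\<bar> < \<delta>" for s
  proof -
    have "(\<lambda>n. (deriv ^^ n) \<psi> 0 / fact n * (of_real s - 0) ^ n) sums \<psi> (of_real s)"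
      by (rule holomorphic_power_series[OF hol\<psi>]) (use that in simp)
    then have "(\<lambda>n. Re ((deriv ^^ n) \<psi> 0 / fact n * (of_real s) ^ n)) sums Re (\<psi> (of_real s))"
      using bounded_linear.sums[OF bounded_linear_Re] by fastforce
    moreover have "Re (\<psi> (of_real s)) = Im (l (of_real (g s)))"
      using ph_real[of "g s"] kreal[OF that] by (simp add: \<psi>_def g_def)
    moreover have "Re ((deriv ^^ n) \<psi> 0 / fact n * (of_real s) ^ n) = a n * s ^ n" for n
      unfolding a_def of_real_power[symmetric] times_complex.sel by (simp del: of_real_power)
    ultimately show ?thesis by simp
  qed
  have hg: "h (of_real (g s)) = of_real s" and gball: "of_real (g s) \<in> ball (0::complex) r1"
    if "\<bar>s\<bar> < \<delta>" for s
    using kin[of "of_real s"] kreal[OF that] that by (auto simp: g_def)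
  show thesis
  proof (rule that[OF m \<delta>(1), of g a])
    show "\<bar>g s\<bar> < R" if "\<bar>s\<bar> < \<delta>" for s
    proof -
      have "of_real (g s) \<in> ball (0::complex) R" using gball[OF that] r1(2) r(2) by blast
      then show ?thesis by simp
    qed
    show "inj_on g {-\<delta><..<\<delta>}"
    proof (rule inj_onI)
      fix s t assume "s \<in> {-\<delta><..<\<delta>}" "t \<in> {-\<delta><..<\<delta>}" and gst: "g s = g t"
      then have "\<bar>s\<bar> < \<delta>" "\<bar>t\<bar> < \<delta>" by auto
      then have "of_real s = (of_real t :: complex)" using hg gst by metis
      then show "s = t" by simp
    qed
    show "summable (\<lambda>n. a n * s ^ n)" if "\<bar>s\<bar> < \<delta>" for s using ser[OF that] sums_summable by blast
    show "f (of_real (g s)) = of_real (s ^ m) * cis (\<Sum>n. a n * s ^ n)" if "\<bar>s\<bar> < \<delta>" for s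
    proof -
      define t :: complex where "t = of_real (g s)"
      have t: "t \<in> ball 0 r" using gball[OF that] r1 t_def by blast
      have "f t = t ^ m * exp (of_real (Re (l t))) * cis (Im (l t))"
        using fq[OF t] l[OF t] by (simp add: exp_eq_polar mult.assoc)
      also have "t ^ m * exp (of_real (Re (l t))) = h t ^ m"
        using m mo_real[of "g s"] by (simp add: h_def t_def power_mult_distrib flip: exp_of_nat_mult)
      also have "h t = of_real s" using hg[OF that] t_def by simp
      finally show ?thesis using ser[OF that] by (simp add: t_def sums_iff)
    qed
  qed
qed

text \<open>
  The Puiseux expansion of a real branch in polar coordinates: at parameter \<open>s\<close> the distance to
  \<open>p\<close> is \<open>\<bar>s\<bar> ^ m\<close>, so one meets the circles centred at \<open>p\<close> at explicit parameters.
\<close>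
lemma branch_polar_form:
  assumes "real_branch p S"
  obtains m \<delta> and a :: "nat \<Rightarrow> real" where "0 < m" "0 < \<delta>"
    "\<And>s. \<bar>s\<bar> < \<delta> \<Longrightarrow> summable (\<lambda>n. a n * s ^ n)"
    "\<And>s. \<bar>s\<bar> < \<delta> \<Longrightarrow> p + s ^ m *\<^sub>R direction (\<Sum>n. a n * s ^ n) \<in> S"
    "inj_on (\<lambda>s. p + s ^ m *\<^sub>R direction (\<Sum>n. a n * s ^ n)) {-\<delta><..<\<delta>}"
proof -
  obtain \<gamma> \<epsilon> where \<epsilon>: "0 < \<epsilon>" and an: "real_analytic_on \<gamma> {-\<epsilon><..<\<epsilon>}"
    and inj: "inj_on \<gamma> {-\<epsilon><..<\<epsilon>}" and \<gamma>: "\<gamma> 0 = p" "S = \<gamma> ` {-\<epsilon><..<\<epsilon>}"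
    using assms unfolding real_branch_def by blast
  obtain f R where R: "0 < R" "R \<le> \<epsilon>" and holf: "f holomorphic_on ball 0 R"
    and f: "\<And>t. \<bar>t\<bar> < R \<Longrightarrow> \<gamma> t - \<gamma> 0 = (Re (f (of_real t)), Im (f (of_real t)))" and f0: "f 0 = 0"
    by (rule analytic_arc_complexification[OF an \<epsilon>]) auto
  have "\<not> f constant_on ball 0 R"
  proof
    assume "f constant_on ball 0 R"
    then have "f (of_real (R / 2)) = f 0" using R(1) by (auto simp: constant_on_def)
    then have "\<gamma> (R / 2) = \<gamma> 0" using f[of "R / 2"] f0 R(1) by (simp add: zero_prod_def[symmetric])
    then have "R / 2 = 0" using inj R by (auto dest!: inj_onD)
    then show False using R(1) by simp
  qed
  then obtain m \<delta> g and a :: "nat \<Rightarrow> real" where m: "0 < m" "0 < \<delta>"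
    and g: "\<And>s. \<bar>s\<bar> < \<delta> \<Longrightarrow> \<bar>g s\<bar> < R" "inj_on g {-\<delta><..<\<delta>}"
    and summ: "\<And>s. \<bar>s\<bar> < \<delta> \<Longrightarrow> summable (\<lambda>n. a n * s ^ n)"
    and eq: "\<And>s. \<bar>s\<bar> < \<delta> \<Longrightarrow> f (of_real (g s)) = of_real (s ^ m) * cis (\<Sum>n. a n * s ^ n)"
    by (rule holomorphic_polar_reparametrization[OF holf R(1) f0]) auto
  have \<gamma>g: "p + s ^ m *\<^sub>R direction (\<Sum>n. a n * s ^ n) = \<gamma> (g s)"
    if "\<bar>s\<bar> < \<delta>" for s
  proof -
    have "\<gamma> (g s) = p + (Re (f (of_real (g s))), Im (f (of_real (g s))))"
      using f[OF g(1)[OF that]] \<gamma>(1) by (metis add.commute diff_add_cancel)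
    then show ?thesis using eq[OF that] by (simp del: of_real_power)
  qed
  have gin: "g s \<in> {-\<epsilon><..<\<epsilon>}" if "\<bar>s\<bar> < \<delta>" for s using g(1)[OF that] R(2) by auto
  show thesis
  proof (rule that[OF m summ])
    show "p + s ^ m *\<^sub>R direction (\<Sum>n. a n * s ^ n) \<in> S" if "\<bar>s\<bar> < \<delta>" for s
      using \<gamma>g[OF that] gin[OF that] \<gamma>(2) by simp
    show "inj_on (\<lambda>s. p + s ^ m *\<^sub>R direction (\<Sum>n. a n * s ^ n)) {-\<delta><..<\<delta>}"
    proof (rule inj_onI)
      fix s t assume s: "s \<in> {-\<delta><..<\<delta>}" and t: "t \<in> {-\<delta><..<\<delta>}"
        and st: "p + s ^ m *\<^sub>R direction (\<Sum>n. a n * s ^ n) =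
             p + t ^ m *\<^sub>R direction (\<Sum>n. a n * t ^ n)"
      have s': "\<bar>s\<bar> < \<delta>" and t': "\<bar>t\<bar> < \<delta>" using s t by auto
      have "\<gamma> (g s) = \<gamma> (g t)" using st unfolding \<gamma>g[OF s'] \<gamma>g[OF t'] .
      then have "g s = g t" using inj gin s t by (auto dest!: inj_onD)
      then show "s = t" using g(2) s t by (auto dest: inj_onD)
    qed
  qed
qed

section \<open>Power series on a small interval\<close>

lemma powser_leading_sign:
  fixes d :: "nat \<Rightarrow> real"
  assumes summ: "summable (\<lambda>n. d n * x ^ n)" and "0 < x"
    and zero: "\<And>j. j < n \<Longrightarrow> d j = 0" and pos: "d n > 0"
  shows "\<forall>\<^sub>F \<rho> in at_right 0. (\<Sum>j. d j * \<rho> ^ j) > 0"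
proof -
  have inside: "summable (\<lambda>j. d j * \<rho> ^ j)" if "\<bar>\<rho>\<bar> < x" for \<rho>
    by (rule powser_inside[OF summ]) (use that in auto)
  define f where "f \<rho> = (\<Sum>j. d (j + n) * \<rho> ^ j)" for \<rho>
  have summ': "summable (\<lambda>j. d (j + n) * y ^ j)" if "\<bar>y\<bar> < x" "y \<noteq> 0" for y
  proof -
    have "summable (\<lambda>j. inverse (y ^ n) * (d (j + n) * y ^ (j + n)))"
      using inside[OF that(1)] by (intro summable_mult) (subst summable_iff_shift)
    then show ?thesis using that(2) by (simp add: power_add field_simps)
  qed
  have half: "\<bar>x / 2\<bar> < x" "x / 2 \<noteq> 0" using \<open>0 < x\<close> by auto
  have "isCont f 0" unfolding f_def
    by (rule isCont_powser[OF summ'[OF half]]) (use \<open>0 < x\<close> in auto)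
  moreover have "f 0 > 0" using pos by (simp add: f_def)
  ultimately have "\<forall>\<^sub>F \<rho> in at 0. f \<rho> > 0"
    unfolding isCont_def by (rule order_tendstoD)
  then have "\<forall>\<^sub>F \<rho> in at_right 0. f \<rho> > 0"
    by (rule filter_leD[rotated]) (simp add: at_le)
  moreover have "\<forall>\<^sub>F \<rho> in at_right 0. \<rho> > 0 \<and> \<rho> < x"
    using \<open>0 < x\<close> by (auto simp: eventually_at_right_field)
  ultimately show ?thesis
  proof eventually_elim
    case (elim \<rho>)
    have "(\<Sum>j. d j * \<rho> ^ j) = (\<Sum>j. d (j + n) * \<rho> ^ (j + n)) + (\<Sum>j<n. d j * \<rho> ^ j)"
      using inside[of \<rho>] elim by (intro suminf_split_initial_segment) auto
    also have "(\<Sum>j<n. d j * \<rho> ^ j) = 0" using zero by simp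
    also have "(\<Sum>j. d (j + n) * \<rho> ^ (j + n)) = \<rho> ^ n * f \<rho>"
      unfolding f_def using summ'[of \<rho>] elim
      by (subst suminf_mult[symmetric]) (auto simp: power_add mult_ac)
    finally show ?case using elim by simp
  qed
qed

text \<open>
  The radius must be small enough for all lifts at once. This is possible because the lifts
  whose distance at \<open>\<rho> = 0\<close> exceeds 1 are ordered by their constant terms, and only finitely
  many others remain.
\<close>
lemma order_by_leading_coefficient:
  fixes a b :: "nat \<Rightarrow> real"
  assumes sa: "summable (\<lambda>n. a n * x ^ n)" and sb: "summable (\<lambda>n. b n * x ^ n)" and "0 < x"
  shows "\<forall>\<^sub>F \<rho> in at_right 0. \<forall>z::int.
     (\<Sum>n. a n * \<rho> ^ n) < (\<Sum>n. b n * \<rho> ^ n) + 2 * pi * z \<longrightarrow>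
     (\<exists>n. (\<forall>j<n. a j = b j + (if j = 0 then 2 * pi * z else 0)) \<and>
          a n < b n + (if n = 0 then 2 * pi * z else 0))"
    (is "\<forall>\<^sub>F \<rho> in at_right 0. \<forall>z. ?less \<rho> z \<longrightarrow> ?lex z")
proof -
  define d where "d z n = b n + (if n = 0 then 2 * pi * of_int z else 0) - a n" for z :: int and n :: nat
  have shift: "(\<lambda>n. if n = 0 then t else (0::real)) sums t" for t
    using sums_single[of 0 "\<lambda>_. t"] by (simp add: eq_commute)
  have d_sums: "(\<lambda>n. d z n * \<rho> ^ n) sums ((\<Sum>n. b n * \<rho> ^ n) + 2 * pi * z - (\<Sum>n. a n * \<rho> ^ n))"
    if "\<bar>\<rho>\<bar> \<le> x" "0 < \<rho>" for z \<rho>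
  proof -
    have "summable (\<lambda>n. a n * \<rho> ^ n)" "summable (\<lambda>n. b n * \<rho> ^ n)"
      using powser_inside[OF sa, of \<rho>] powser_inside[OF sb, of \<rho>] sa sb that \<open>0 < x\<close>
      by (cases "\<rho> = x"; simp)+
    then have "(\<lambda>n. b n * \<rho> ^ n + (if n = 0 then 2 * pi * of_int z else 0) - a n * \<rho> ^ n) sums
        ((\<Sum>n. b n * \<rho> ^ n) + 2 * pi * z - (\<Sum>n. a n * \<rho> ^ n))"
      by (intro sums_diff sums_add summable_sums shift)
    moreover have "b n * \<rho> ^ n + (if n = 0 then 2 * pi * of_int z else 0) - a n * \<rho> ^ n = d z n * \<rho> ^ n" for n
      by (simp add: d_def algebra_simps)
    ultimately show ?thesis by simp
  qed
  have small: "\<forall>\<^sub>F \<rho> in at_right 0. 0 < \<rho> \<and> \<rho> < x"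
    using \<open>0 < x\<close> by (auto simp: eventually_at_right_field)
  have single: "\<forall>\<^sub>F \<rho> in at_right 0. ?less \<rho> z \<longrightarrow> ?lex z" for z
  proof (cases "?lex z")
    case False
    have nlex: "\<not> d z n > 0" if low: "\<And>j. j < n \<Longrightarrow> d z j = 0" for n
    proof
      assume "d z n > 0"
      then have "a n < b n + (if n = 0 then 2 * pi * z else 0)" by (simp add: d_def)
      moreover have "a j = b j + (if j = 0 then 2 * pi * z else 0)" if "j < n" for j
        using low[OF that] by (simp add: d_def)
      ultimately show False using False by blast
    qed
    show ?thesis
    proof (cases "\<forall>n. d z n = 0")
      case True
      show ?thesis using small
      proof eventually_elim
        case (elim \<rho>)
        then show ?case using d_sums[of \<rho> z] True by (auto simp: sums_iff)
      qed
    next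
      case nz: False
      define n where "n = (LEAST n. d z n \<noteq> 0)"
      have n: "d z n \<noteq> 0" "\<And>j. j < n \<Longrightarrow> d z j = 0"
        using LeastI_ex[of "\<lambda>n. d z n \<noteq> 0"] not_less_Least[of _ "\<lambda>n. d z n \<noteq> 0"] nz
        unfolding n_def by blast+
      have "\<forall>\<^sub>F \<rho> in at_right 0. (\<Sum>j. - d z j * \<rho> ^ j) > 0"
      proof (rule powser_leading_sign[OF _ \<open>0 < x\<close>])
        show "summable (\<lambda>n. - d z n * x ^ n)"
          using summable_minus[OF sums_summable[OF d_sums[of x z]]] \<open>0 < x\<close> by simp
        show "0 < - d z n" using n(1) nlex[of n, OF n(2)] by linarith
      qed (use n in auto)
      with small show ?thesis
      proof eventually_elim
        case (elim \<rho>)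
        have s: "(\<lambda>n. d z n * \<rho> ^ n) sums ((\<Sum>n. b n * \<rho> ^ n) + 2 * pi * z - (\<Sum>n. a n * \<rho> ^ n))"
          using d_sums[of \<rho> z] elim by simp
        then show ?case using elim sums_unique[OF sums_minus[OF s]] by simp
      qed
    qed
  qed simp
  define Z where "Z = {z::int. \<bar>b 0 - a 0 + 2 * pi * z\<bar> \<le> 1}"
  have "Z \<subseteq> {\<lfloor>(- 1 - (b 0 - a 0)) / (2 * pi)\<rfloor> .. \<lceil>(1 - (b 0 - a 0)) / (2 * pi)\<rceil>}"
  proof
    fix z assume "z \<in> Z"
    then have "(- 1 - (b 0 - a 0)) / (2 * pi) \<le> of_int z" "of_int z \<le> (1 - (b 0 - a 0)) / (2 * pi)"
      by (auto simp: Z_def field_simps)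
    then show "z \<in> {\<lfloor>(- 1 - (b 0 - a 0)) / (2 * pi)\<rfloor> .. \<lceil>(1 - (b 0 - a 0)) / (2 * pi)\<rceil>}"
      by (auto simp: floor_le_iff le_ceiling_iff)
  qed
  then have "finite Z" using finite_subset by blast
  then have in_Z: "\<forall>\<^sub>F \<rho> in at_right 0. \<forall>z\<in>Z. ?less \<rho> z \<longrightarrow> ?lex z"
    using single by (simp add: eventually_ball_finite)
  have tend: "((\<lambda>\<rho>. \<Sum>n. c n * \<rho> ^ n) \<longlongrightarrow> c 0) (at_right 0)"
    if "summable (\<lambda>n. c n * x ^ n)" for c
  proof -
    have "isCont (\<lambda>\<rho>. \<Sum>n. c n * \<rho> ^ n) 0"
      by (rule isCont_powser[OF that]) (use \<open>0 < x\<close> in simp)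
    then have "((\<lambda>\<rho>. \<Sum>n. c n * \<rho> ^ n) \<longlongrightarrow> c 0) (at 0)"
      by (simp add: isCont_def)
    then show ?thesis by (rule tendsto_mono[rotated]) (simp add: at_le)
  qed
  have "((\<lambda>\<rho>. (\<Sum>n. b n * \<rho> ^ n) - (\<Sum>n. a n * \<rho> ^ n)) \<longlongrightarrow> b 0 - a 0) (at_right 0)"
    by (intro tendsto_diff tend sa sb)
  then have "\<forall>\<^sub>F \<rho> in at_right 0. dist ((\<Sum>n. b n * \<rho> ^ n) - (\<Sum>n. a n * \<rho> ^ n)) (b 0 - a 0) < 1"
    by (rule tendstoD) simp
  with in_Z show ?thesis
  proof eventually_elim
    case (elim \<rho>)
    show ?case
    proof (intro allI impI)
      fix z assume less: "?less \<rho> z"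
      show "?lex z"
      proof (cases "z \<in> Z")
        case False
        then have "a 0 < b 0 + 2 * pi * z" using elim(2) less
          by (auto simp: Z_def dist_real_def abs_if split: if_splits)
        then show ?thesis by (intro exI[of _ 0]) simp
      qed (use elim less in blast)
    qed
  qed
qed

section \<open>The ends of a branch on a small circle\<close>

text \<open>
  The two ends of a branch of multiplicity \<open>m\<close>, as functions of the \<open>(m * N)\<close>-th root
  \<open>\<rho>\<close> of the radius. They sit at the parameters \<open>\<rho> ^ N\<close> (\<open>True\<close>) and \<open>- (\<rho> ^ N)\<close> (\<open>False\<close>).
  For odd \<open>m\<close> the factor \<open>s ^ m\<close> of the polar form is negative at the second one; the
  summand \<open>pi\<close> absorbs its sign. The free factor \<open>N\<close> brings several branches to the same \<open>\<rho>\<close>.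
\<close>
definition expands_ends ::
    "real \<times> real \<Rightarrow> (real \<times> real) set \<Rightarrow> nat \<Rightarrow> nat \<Rightarrow> (bool \<Rightarrow> nat \<Rightarrow> real) \<Rightarrow> bool" where
  "expands_ends p S m N g \<longleftrightarrow>
    (\<forall>s n. 0 < n \<longrightarrow> g s n \<noteq> 0 \<longrightarrow> N dvd n) \<and>
    (\<forall>s n. 0 < n \<longrightarrow> g (\<not> s) n = (-1) ^ (n div N) * g s n) \<and>
    g False 0 = g True 0 + (if odd m then pi else 0) \<and>
    (\<forall>\<^sub>F \<rho> in at_right 0.
      (\<forall>s. summable (\<lambda>n. g s n * \<rho> ^ n) \<and> p + \<rho> ^ (m * N) *\<^sub>R direction (\<Sum>n. g s n * \<rho> ^ n) \<in> S) \<and>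
      p + \<rho> ^ (m * N) *\<^sub>R direction (\<Sum>n. g True n * \<rho> ^ n) \<noteq>
      p + \<rho> ^ (m * N) *\<^sub>R direction (\<Sum>n. g False n * \<rho> ^ n))"

lemma branch_end_expansions:
  assumes "real_branch p S"
  obtains m where "0 < m" "\<And>N. 0 < N \<Longrightarrow> \<exists>g. expands_ends p S m N g"
proof -
  obtain m \<delta> and a :: "nat \<Rightarrow> real" where m: "0 < m" and \<delta>: "0 < \<delta>"
    and summ: "\<And>s. \<bar>s\<bar> < \<delta> \<Longrightarrow> summable (\<lambda>n. a n * s ^ n)"
    and mem: "\<And>s. \<bar>s\<bar> < \<delta> \<Longrightarrow> p + s ^ m *\<^sub>R direction (\<Sum>n. a n * s ^ n) \<in> S"
    and inj: "inj_on (\<lambda>s. p + s ^ m *\<^sub>R direction (\<Sum>n. a n * s ^ n)) {-\<delta><..<\<delta>}"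
    by (rule branch_polar_form[OF assms]) blast
  define P where "P s = p + s ^ m *\<^sub>R direction (\<Sum>n. a n * s ^ n)" for s
  have inj_P: "inj_on P {-\<delta><..<\<delta>}" using inj by (simp add: P_def[abs_def])
  show thesis
  proof (rule that[OF m])
    fix N :: nat assume N: "0 < N"
    define sg :: "bool \<Rightarrow> real" where "sg s = (if s then 1 else -1)" for s
    define g where "g s n = (if N dvd n then a (n div N) * sg s ^ (n div N) else 0) +
      (if n = 0 \<and> \<not> s \<and> odd m then pi else 0)" for s n
    have g_sums: "(\<lambda>n. g s n * \<rho> ^ n) sums
        ((\<Sum>n. a n * (sg s * \<rho> ^ N) ^ n) + (if \<not> s \<and> odd m then pi else 0))"
      if "\<bar>sg s * \<rho> ^ N\<bar> < \<delta>" for s \<rho>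
    proof -
      have "strict_mono (\<lambda>n. N * n)" using N by (simp add: strict_mono_def)
      moreover have "(if N dvd n then a (n div N) * sg s ^ (n div N) * \<rho> ^ n else 0) = 0"
        if "n \<notin> range (\<lambda>n. N * n)" for n using that by auto
      moreover have "(\<lambda>n. a n * sg s ^ n * \<rho> ^ (N * n)) sums (\<Sum>n. a n * (sg s * \<rho> ^ N) ^ n)"
        using summable_sums[OF summ[OF that]] by (simp add: power_mult_distrib power_mult mult.assoc)
      ultimately have "(\<lambda>n. if N dvd n then a (n div N) * sg s ^ (n div N) * \<rho> ^ n else 0) sums
          (\<Sum>n. a n * (sg s * \<rho> ^ N) ^ n)"
        using sums_mono_reindex[of "\<lambda>n. N * n"
            "\<lambda>n. if N dvd n then a (n div N) * sg s ^ (n div N) * \<rho> ^ n else 0"] N by simp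
      moreover have "(\<lambda>n. if n = 0 then t else (0::real)) sums t" for t
        using sums_single[of 0 "\<lambda>_. t"] by (simp add: eq_commute)
      ultimately have "(\<lambda>n. (if N dvd n then a (n div N) * sg s ^ (n div N) * \<rho> ^ n else 0) +
            (if n = 0 then if \<not> s \<and> odd m then pi else 0 else 0)) sums
          ((\<Sum>n. a n * (sg s * \<rho> ^ N) ^ n) + (if \<not> s \<and> odd m then pi else 0))"
        by (rule sums_add)
      moreover have "(if N dvd n then a (n div N) * sg s ^ (n div N) * \<rho> ^ n else 0) +
            (if n = 0 then if \<not> s \<and> odd m then pi else 0 else 0) = g s n * \<rho> ^ n" for n
        by (auto simp: g_def)
      ultimately show ?thesis by simp
    qed
    have pt: "p + \<rho> ^ (m * N) *\<^sub>R direction (\<Sum>n. g s n * \<rho> ^ n) = P (sg s * \<rho> ^ N)"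
      if "\<bar>sg s * \<rho> ^ N\<bar> < \<delta>" for s \<rho>
      unfolding sums_unique[OF g_sums[OF that], symmetric] P_def
      by (cases s; cases "even m") (auto simp: sg_def power_mult_distrib mult.commute simp flip: power_mult)
    have "((\<lambda>\<rho>. \<rho> ^ N) \<longlongrightarrow> 0) (at_right (0::real))"
      using N by (auto intro!: tendsto_eq_intros)
    then have "\<forall>\<^sub>F \<rho> in at_right 0. \<rho> ^ N < \<delta>" using \<delta> by (rule order_tendstoD)
    moreover have "\<forall>\<^sub>F \<rho> in at_right (0::real). \<rho> > 0" by (simp add: eventually_at_right_less)
    ultimately have ev: "\<forall>\<^sub>F \<rho> in at_right 0.
        (\<forall>s. summable (\<lambda>n. g s n * \<rho> ^ n) \<and> p + \<rho> ^ (m * N) *\<^sub>R direction (\<Sum>n. g s n * \<rho> ^ n) \<in> S) \<and>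
        p + \<rho> ^ (m * N) *\<^sub>R direction (\<Sum>n. g True n * \<rho> ^ n) \<noteq>
        p + \<rho> ^ (m * N) *\<^sub>R direction (\<Sum>n. g False n * \<rho> ^ n)"
    proof eventually_elim
      case (elim \<rho>)
      have small: "\<bar>sg s * \<rho> ^ N\<bar> < \<delta>" for s using elim by (simp add: sg_def)
      have "sg True * \<rho> ^ N \<noteq> sg False * \<rho> ^ N" using elim by (simp add: sg_def)
      moreover have "sg s * \<rho> ^ N \<in> {-\<delta><..<\<delta>}" for s using small[of s] by (auto simp: abs_less_iff)
      ultimately have "P (sg True * \<rho> ^ N) \<noteq> P (sg False * \<rho> ^ N)"
        using inj_P by (metis inj_onD)
      then show ?case
        using pt[OF small] mem[OF small] sums_summable[OF g_sums[OF small]] by (simp add: P_def)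
    qed
    have "\<forall>s n. 0 < n \<longrightarrow> g s n \<noteq> 0 \<longrightarrow> N dvd n" by (auto simp: g_def)
    moreover have "\<forall>s n. 0 < n \<longrightarrow> g (\<not> s) n = (-1) ^ (n div N) * g s n"
      by (auto simp: g_def sg_def simp flip: power_mult_distrib)
    moreover have "g False 0 = g True 0 + (if odd m then pi else 0)" by (simp add: g_def)
    ultimately have "expands_ends p S m N g" using ev unfolding expands_ends_def by (intro conjI)
    then show "\<exists>g. expands_ends p S m N g" by blast
  qed
qed

text \<open>
  Unrolling the circle: continued periodically, the word is read along the whole line of angles
  and has no distinguished starting point.
\<close>
lemma lifted_reading:
  assumes "reads_cyclic_word \<Gamma> p r w" "w \<noteq> []"
  obtains \<theta> :: "int \<Rightarrow> real" where "strict_mono \<theta>"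
    "\<And>k q. \<theta> (k + int (length w) * q) = \<theta> k + 2 * pi * q"
    "\<And>i. \<Gamma> i \<inter> sphere p r = {p + r *\<^sub>R direction (\<theta> k) | k. w ! nat (k mod int (length w)) = i}"
proof -
  define L where "L = int (length w)"
  have L: "L > 0" using assms(2) by (simp add: L_def)
  obtain \<theta> where \<theta>: "strict_mono_on {..<length w} \<theta> \<and> (\<forall>k<length w. \<theta> k < \<theta> 0 + 2 * pi) \<and>
      (\<forall>i. \<Gamma> i \<inter> sphere p r = {p + r *\<^sub>R direction (\<theta> k) | k. k < length w \<and> w ! k = i})"
    using assms(1) unfolding reads_cyclic_word_def by (elim exE)
  have mono: "strict_mono_on {..<length w} \<theta>" using \<theta> by (rule conjunct1)
  have less: "\<theta> k < \<theta> 0 + 2 * pi" if "k < length w" for k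
    using \<theta>[THEN conjunct2, THEN conjunct1] that by blast
  have pts: "\<Gamma> i \<inter> sphere p r = {p + r *\<^sub>R direction (\<theta> k) | k. k < length w \<and> w ! k = i}" for i
    by (rule \<theta>[THEN conjunct2, THEN conjunct2, THEN spec])
  define \<phi> where "\<phi> k = \<theta> (nat (k mod L)) + 2 * pi * of_int (k div L)" for k
  have in_range: "nat (k mod L) < length w" for k
    using L by (simp add: L_def nat_less_iff)
  have base: "\<theta> 0 \<le> \<theta> k" if "k < length w" for k
    using strict_mono_onD[OF mono, of 0 k] that assms(2) by (cases "k = 0") auto
  have "\<phi> k < \<phi> l" if "k < l" for k l
  proof -
    have "k div L \<le> l div L" using that L by (simp add: zdiv_mono1)
    then consider "k div L = l div L" | "k div L + 1 \<le> l div L" by linarith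
    then show ?thesis
    proof cases
      case 1
      then have "k mod L < l mod L" using that by (metis add_less_cancel_left div_mult_mod_eq)
      then have "nat (k mod L) < nat (l mod L)" using pos_mod_sign[OF L, of k] by simp
      then show ?thesis using 1 strict_mono_onD[OF mono] in_range by (simp add: \<phi>_def)
    next
      case 2
      then have "real_of_int (k div L) + 1 \<le> of_int (l div L)" by linarith
      then have "2 * pi * (real_of_int (k div L) + 1) \<le> 2 * pi * of_int (l div L)"
        by (intro mult_left_mono) auto
      then show ?thesis using less[OF in_range[of k]] base[OF in_range[of l]]
        by (simp add: \<phi>_def algebra_simps)
    qed
  qed
  then have "strict_mono \<phi>" by (simp add: strict_mono_def)
  moreover have "\<phi> (k + L * q) = \<phi> k + 2 * pi * q" for k q
    using L by (simp add: \<phi>_def algebra_simps)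
  moreover have "\<Gamma> i \<inter> sphere p r = {p + r *\<^sub>R direction (\<phi> k) | k. w ! nat (k mod L) = i}" for i
  proof -
    have dir: "direction (\<phi> k) = direction (\<theta> (nat (k mod L)))" for k
      using sin_cos_eq_iff[of "\<phi> k" "\<theta> (nat (k mod L))"] by (auto simp: \<phi>_def)
    show ?thesis unfolding pts
    proof (intro subset_antisym subsetI)
      fix y assume "y \<in> {p + r *\<^sub>R direction (\<theta> k) | k. k < length w \<and> w ! k = i}"
      then obtain k where k: "y = p + r *\<^sub>R direction (\<theta> k)" "k < length w" "w ! k = i" by blast
      then have m: "nat (int k mod L) = k" by (simp add: L_def)
      then have "y = p + r *\<^sub>R direction (\<phi> (int k))" using dir[of "int k"] k(1) by simp
      moreover have "w ! nat (int k mod L) = i" using m k(3) by simp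
      ultimately show "y \<in> {p + r *\<^sub>R direction (\<phi> k) | k. w ! nat (k mod L) = i}" by blast
    next
      fix y assume "y \<in> {p + r *\<^sub>R direction (\<phi> k) | k. w ! nat (k mod L) = i}"
      then obtain k where "y = p + r *\<^sub>R direction (\<phi> k)" "w ! nat (k mod L) = i" by blast
      then show "y \<in> {p + r *\<^sub>R direction (\<theta> k) | k. k < length w \<and> w ! k = i}"
        using dir[of k] in_range[of k] by auto
    qed
  qed
  ultimately show thesis using that by (simp add: L_def)
qed

section \<open>Cyclic words of analytic branches\<close>

lemma direction_eq_iff:
  assumes "r \<noteq> 0"
  shows "p + r *\<^sub>R direction x = p + r *\<^sub>R direction y \<longleftrightarrow> (\<exists>z::int. x = y + 2 * pi * z)"
  using assms sin_cos_eq_iff[of x y] by auto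

text \<open>
  All branches are expanded in the same variable \<open>\<rho>\<close>, with \<open>\<rho> ^ M\<close> the radius. One fixed small
  \<open>\<rho>\<close> suffices, because the order of the ends along the circle is decided by their first
  distinct coefficients; the lifted ends at this radius satisfy \<^locale>\<open>lifted_ends\<close>.
\<close>
theorem analytic_word_repeats_adjacency:
  fixes \<Gamma> :: "'i::finite \<Rightarrow> (real \<times> real) set"
  assumes germ: "germ_branches Z p \<Gamma>"
    and reads: "\<forall>\<^sub>F r in at_right 0. reads_cyclic_word \<Gamma> p r w"
    and "w \<noteq> []"
    and no_double: "\<And>k. k < length w \<Longrightarrow> w ! k \<noteq> w ! (Suc k mod length w)"
  shows "\<exists>k < length w. \<exists>l < length w. k \<noteq> l \<and>
    {w ! k, w ! (Suc k mod length w)} = {w ! l, w ! (Suc l mod length w)}"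
proof (rule ccontr)
  assume no_repeat: "\<not> ?thesis"
  have branch: "real_branch p (\<Gamma> i)" for i
    using germ unfolding germ_branches_def by (elim conjE allE)
  have two: "\<forall>\<^sub>F r in at_right 0. card (\<Gamma> i \<inter> sphere p r) = 2" for i
    using germ unfolding germ_branches_def by (elim conjE allE)
  obtain U where U: "open U" "p \<in> U" and meet: "\<forall>i j. i \<noteq> j \<longrightarrow> \<Gamma> i \<inter> \<Gamma> j \<inter> U = {p}"
    using germ unfolding germ_branches_def by (elim conjE exE)
  have "\<exists>m. 0 < m \<and> (\<forall>N>0. \<exists>g. expands_ends p (\<Gamma> i) m N g)" for i
    by (rule branch_end_expansions[OF branch[of i]]) blast
  then obtain m where m: "\<And>i. 0 < m i" and ex_g: "\<And>i N. 0 < N \<Longrightarrow> \<exists>g. expands_ends p (\<Gamma> i) (m i) N g"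
    by metis
  define M where "M = (\<Prod>i\<in>UNIV. m i)"
  define N where "N i = (\<Prod>j\<in>UNIV - {i}. m j)" for i
  have MN: "m i * N i = M" and N: "0 < N i" for i
    using m by (auto simp: M_def N_def prod.remove[of UNIV i] intro!: prod_pos)
  have M: "0 < M" using m by (simp add: M_def prod_pos)
  have "\<exists>g. \<forall>i. expands_ends p (\<Gamma> i) (m i) (N i) (g i)"
    by (rule choice) (use ex_g N in blast)
  then obtain g where gQ: "\<And>i. expands_ends p (\<Gamma> i) (m i) (N i) (g i)" by blast
  have supp: "N i dvd n" if "0 < n" "g i s n \<noteq> 0" for i s n
    using gQ[of i, unfolded expands_ends_def, THEN conjunct1] that by blast
  have conj: "g i (\<not> s) n = (-1) ^ (n div N i) * g i s n" if "0 < n" for i s n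
    using gQ[of i, unfolded expands_ends_def, THEN conjunct2, THEN conjunct1] that by blast
  have conj0: "g i False 0 = g i True 0 + (if odd (m i) then pi else 0)" for i
    using gQ[of i, unfolded expands_ends_def, THEN conjunct2, THEN conjunct2, THEN conjunct1] .
  note ev_g = gQ[unfolded expands_ends_def MN, THEN conjunct2, THEN conjunct2, THEN conjunct2]
  define val where "val \<rho> h = (\<Sum>n. g (fst h) (snd h) n * \<rho> ^ n)" for \<rho> h
  define pt where "pt \<rho> x = p + \<rho> ^ M *\<^sub>R direction x" for \<rho> x :: real
  \<comment> \<open>End \<open>h\<close> comes before end \<open>h'\<close> lifted by \<open>z\<close> turns, according to the coefficients.\<close>
  define lexless where "lexless h h' z \<longleftrightarrow>
     (\<exists>n. (\<forall>j<n. g (fst h) (snd h) j = g (fst h') (snd h') j + (if j = 0 then 2 * pi * of_int z else 0)) \<and>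
          g (fst h) (snd h) n < g (fst h') (snd h') n + (if n = 0 then 2 * pi * of_int z else 0))"
    for h h' :: "'i \<times> bool" and z :: int
  have ev1: "\<forall>\<^sub>F \<rho> in at_right 0. \<forall>i. (\<forall>s. summable (\<lambda>n. g i s n * \<rho> ^ n) \<and> pt \<rho> (val \<rho> (i, s)) \<in> \<Gamma> i) \<and>
        pt \<rho> (val \<rho> (i, True)) \<noteq> pt \<rho> (val \<rho> (i, False))"
    unfolding pt_def val_def fst_conv snd_conv by (rule eventually_all_finite[OF ev_g])
  have "\<forall>\<^sub>F \<rho> in at_right (0::real). 0 < \<rho>" by (simp add: eventually_at_right_less)
  with ev1 have "\<forall>\<^sub>F \<rho> in at_right 0. 0 < \<rho> \<and> (\<forall>i s. summable (\<lambda>n. g i s n * \<rho> ^ n))"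
    by eventually_elim blast
  then obtain x where x: "0 < x" "\<And>i s. summable (\<lambda>n. g i s n * x ^ n)"
    using eventually_happens'[OF trivial_limit_at_right_real] by blast
  have ev2: "\<forall>\<^sub>F \<rho> in at_right 0. \<forall>h h'. \<forall>z::int. val \<rho> h < val \<rho> h' + 2 * pi * z \<longrightarrow> lexless h h' z"
    unfolding val_def lexless_def
    by (intro eventually_all_finite order_by_leading_coefficient[OF x(2) x(2) x(1)])
  have pow: "filterlim (\<lambda>\<rho>. \<rho> ^ M) (at_right 0) (at_right (0::real))"
    unfolding filterlim_at
    by (intro conjI) (use M in \<open>auto intro!: tendsto_eq_intros simp: eventually_at_right_less eventually_mono[OF eventually_at_right_less[of 0]]\<close>)
  have "\<forall>\<^sub>F r in at_right 0. reads_cyclic_word \<Gamma> p r w \<and> (\<forall>i. card (\<Gamma> i \<inter> sphere p r) = 2)"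
    using reads eventually_all_finite[OF two] by (rule eventually_conj)
  moreover have "\<forall>\<^sub>F r in at_right 0. sphere p r \<subseteq> U"
  proof -
    obtain d where "d > 0" "ball p d \<subseteq> U" using U openE by blast
    then show ?thesis by (auto simp: eventually_at_right_field intro!: exI[of _ d])
  qed
  ultimately have "\<forall>\<^sub>F r in at_right 0. reads_cyclic_word \<Gamma> p r w \<and>
      (\<forall>i. card (\<Gamma> i \<inter> sphere p r) = 2) \<and> sphere p r \<subseteq> U"
    by eventually_elim blast
  note ev3 = eventually_compose_filterlim[OF this pow]
  have "\<forall>\<^sub>F \<rho> in at_right (0::real). 0 < \<rho>" by (simp add: eventually_at_right_less)
  with ev1 ev2 ev3 have "\<forall>\<^sub>F \<rho> in at_right (0::real). 0 < \<rho> \<and>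
      (\<forall>i. (\<forall>s. pt \<rho> (val \<rho> (i, s)) \<in> \<Gamma> i) \<and> pt \<rho> (val \<rho> (i, True)) \<noteq> pt \<rho> (val \<rho> (i, False))) \<and>
      (\<forall>h h'. \<forall>z::int. val \<rho> h < val \<rho> h' + 2 * pi * z \<longrightarrow> lexless h h' z) \<and>
      reads_cyclic_word \<Gamma> p (\<rho> ^ M) w \<and> (\<forall>i. card (\<Gamma> i \<inter> sphere p (\<rho> ^ M)) = 2) \<and> sphere p (\<rho> ^ M) \<subseteq> U"
    by eventually_elim blast
  then obtain \<rho> :: real where \<rho>: "0 < \<rho>"
    and on: "\<And>i s. pt \<rho> (val \<rho> (i, s)) \<in> \<Gamma> i"
    and diff: "\<And>i. pt \<rho> (val \<rho> (i, True)) \<noteq> pt \<rho> (val \<rho> (i, False))"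
    and lexl: "\<And>h h' z. val \<rho> h < val \<rho> h' + 2 * pi * of_int z \<Longrightarrow> lexless h h' z"
    and word: "reads_cyclic_word \<Gamma> p (\<rho> ^ M) w"
    and card2: "\<And>i. card (\<Gamma> i \<inter> sphere p (\<rho> ^ M)) = 2" and inU: "sphere p (\<rho> ^ M) \<subseteq> U"
    using eventually_happens'[OF trivial_limit_at_right_real] by blast
  define v where "v = val \<rho>"
  define q where "q = pt \<rho>"
  note on = on[folded v_def q_def] and diff = diff[folded v_def q_def] and lexl = lexl[folded v_def]
  have r: "\<rho> ^ M > 0" using \<rho> by simp
  have q_iff: "q x = q y \<longleftrightarrow> (\<exists>z::int. x = y + 2 * pi * z)" for x y
    unfolding q_def pt_def using direction_eq_iff r by (metis less_irrefl)
  have q_sphere: "q x \<in> sphere p (\<rho> ^ M)" for x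
  proof -
    have "norm (direction x) = 1" by (simp add: norm_Pair)
    then show ?thesis using r by (simp add: q_def pt_def dist_norm del: scaleR_Pair)
  qed
  \<comment> \<open>The two expanded ends exhaust the branch on this circle, since it has just two points there.\<close>
  have ends: "\<Gamma> i \<inter> sphere p (\<rho> ^ M) = {q (v (i, True)), q (v (i, False))}" for i
  proof -
    have "card (\<Gamma> i \<inter> sphere p (\<rho> ^ M)) \<noteq> 0" using card2[of i] by linarith
    then have "finite (\<Gamma> i \<inter> sphere p (\<rho> ^ M))" by (rule card_ge_0_finite[OF neq0_conv[THEN iffD1]])
    moreover have "{q (v (i, True)), q (v (i, False))} \<subseteq> \<Gamma> i \<inter> sphere p (\<rho> ^ M)"
      by (intro insert_subsetI IntI on q_sphere empty_subsetI)
    moreover have "card {q (v (i, True)), q (v (i, False))} = card (\<Gamma> i \<inter> sphere p (\<rho> ^ M))"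
      unfolding card2[of i] card_2_iff using diff[of i] by blast
    ultimately show ?thesis by (rule card_subset_eq[symmetric])
  qed
  have qv_inj: "h = h'" if "q (v h) = q (v h')" for h h'
  proof -
    have eq: "fst h = fst h'"
    proof (rule ccontr)
      assume "fst h \<noteq> fst h'"
      moreover have "q (v h) \<in> \<Gamma> (fst h)" "q (v h) \<in> \<Gamma> (fst h')"
        using on[of "fst h" "snd h"] on[of "fst h'" "snd h'"] that by auto
      moreover have "q (v h) \<in> U" using inU q_sphere by blast
      ultimately have "q (v h) = p" using meet by blast
      then have "p \<in> sphere p (\<rho> ^ M)" using q_sphere by metis
      then have "\<rho> ^ M = 0" unfolding mem_sphere dist_self by (rule sym)
      then show False using r by linarith
    qed
    then show ?thesis using that diff by (cases h; cases h') (metis (full_types) fst_conv)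
  qed
  define L where "L = int (length w)"
  have L: "L > 0" using \<open>w \<noteq> []\<close> by (simp add: L_def)
  obtain \<theta> where mono: "strict_mono \<theta>"
    and per': "\<And>k z. \<theta> (k + int (length w) * z) = \<theta> k + 2 * pi * of_int z"
    and pts': "\<And>i. \<Gamma> i \<inter> sphere p (\<rho> ^ M) =
      {p + \<rho> ^ M *\<^sub>R direction (\<theta> k) | k. w ! nat (k mod int (length w)) = i}"
    by (rule lifted_reading[OF word \<open>w \<noteq> []\<close>]) (rule that)
  note per = per'[folded L_def]
  have pts: "\<Gamma> i \<inter> sphere p (\<rho> ^ M) = {q (\<theta> k) | k. w ! nat (k mod L) = i}" for i
    unfolding q_def pt_def L_def by (rule pts')
  define letter where "letter k = w ! nat (k mod L)" for k
  \<comment> \<open>\<open>H k\<close> is the end at the angle \<open>\<theta> k\<close>, and \<open>Z k\<close> counts the turns from its expansion.\<close>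
  have "\<exists>hz. fst (fst hz) = letter k \<and> \<theta> k = v (fst hz) + 2 * pi * of_int (snd hz)" for k
  proof -
    have "q (\<theta> k) \<in> {q (v (letter k, True)), q (v (letter k, False))}"
      using pts ends unfolding letter_def by blast
    then obtain s where "q (\<theta> k) = q (v (letter k, s))" by blast
    then obtain z :: int where "\<theta> k = v (letter k, s) + 2 * pi * z" using q_iff by blast
    then show ?thesis by (intro exI[of _ "((letter k, s), z)"]) simp
  qed
  then obtain HZ where HZ: "\<And>k. fst (fst (HZ k)) = letter k \<and> \<theta> k = v (fst (HZ k)) + 2 * pi * of_int (snd (HZ k))"
    by metis
  define H where "H k = fst (HZ k)" for k
  define Z where "Z k = snd (HZ k)" for k
  have H: "fst (H k) = letter k" and \<theta>: "\<theta> k = v (H k) + 2 * pi * of_int (Z k)" for k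
    using HZ by (auto simp: H_def Z_def)
  have HZ_unique: "H k = h \<and> Z k = z" if "\<theta> k = v h + 2 * pi * of_int z" for k h z
  proof -
    have "v (H k) = v h + 2 * pi * of_int (z - Z k)" using that \<theta>[of k] by (simp add: algebra_simps)
    then have "q (v (H k)) = q (v h)" using q_iff by blast
    then have "H k = h" by (rule qv_inj)
    then show ?thesis using that \<theta>[of k] by simp
  qed
  have HZ_ex: "\<exists>k. H k = h \<and> Z k = z" for h z
  proof -
    have "q (v h) \<in> \<Gamma> (fst h) \<inter> sphere p (\<rho> ^ M)" using on[of "fst h" "snd h"] q_sphere by simp
    then obtain k where "q (v h) = q (\<theta> k)" using pts by auto
    then obtain y :: int where "v h = \<theta> k + 2 * pi * y" using q_iff by blast
    then have "\<theta> (k + L * (y + z)) = v h + 2 * pi * of_int z"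
      unfolding per[of k "y + z"] by (simp add: algebra_simps)
    then show ?thesis using HZ_unique by blast
  qed
  have HZ_inj: "k = l" if "H k = H l" "Z k = Z l" for k l
    using that \<theta>[of k] \<theta>[of l] mono by (metis strict_mono_eq)
  have HZ_per: "H (k + L * z) = H k \<and> Z (k + L * z) = Z k + z" for k z
    by (rule HZ_unique) (simp add: per \<theta>[of k] algebra_simps)
  define c where "c k n = g (letter k) (snd (H k)) n + (if n = 0 then 2 * pi * of_int (Z k) else 0)" for k n
  \<comment> \<open>For odd multiplicity the end \<open>True\<close> has the smaller constant term by \<open>pi\<close>, so going up by
    \<open>pi\<close> from the end \<open>False\<close> leads to the end \<open>True\<close> one turn later.\<close>
  define turn where "turn k = (if odd (m (letter k)) \<and> \<not> snd (H k) then 1 else 0 :: int)" for k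
  have "\<exists>mate. \<forall>k. H (mate k) = (letter k, \<not> snd (H k)) \<and> Z (mate k) = Z k + turn k"
    by (rule choice) (use HZ_ex in blast)
  then obtain mate where mate: "\<And>k. H (mate k) = (letter k, \<not> snd (H k))" "\<And>k. Z (mate k) = Z k + turn k"
    by blast
  have letter_mate: "letter (mate k) = letter k" for k using H[of "mate k"] mate(1)[of k] by simp
  define e where "e i = multiplicity 2 (N i)" for i
  interpret lifted_ends letter c mate e "multiplicity 2 M" L
  proof
    have c_diff: "c k n - c l n = g (letter k) (snd (H k)) n - g (letter l) (snd (H l)) n
        - (if n = 0 then 2 * pi * of_int (Z l - Z k) else 0)" for k l n
      by (simp add: c_def algebra_simps)
    show lex: "\<exists>n. (\<forall>j<n. c k j = c l j) \<and> c k n < c l n" if "k < l" for k l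
    proof -
      have "\<theta> k < \<theta> l" using mono that by (simp add: strict_mono_less)
      then have "v (H k) < v (H l) + 2 * pi * of_int (Z l - Z k)"
        using \<theta>[of k] \<theta>[of l] by (simp add: algebra_simps)
      then have "lexless (H k) (H l) (Z l - Z k)" by (rule lexl)
      then obtain n where n: "\<And>j. j < n \<Longrightarrow> g (letter k) (snd (H k)) j = g (letter l) (snd (H l)) j + (if j = 0 then 2 * pi * of_int (Z l - Z k) else 0)"
        "g (letter k) (snd (H k)) n < g (letter l) (snd (H l)) n + (if n = 0 then 2 * pi * of_int (Z l - Z k) else 0)"
        unfolding lexless_def H by blast
      have "c k j = c l j" if "j < n" for j using n(1)[OF that] c_diff[of k j l] by simp
      moreover have "c k n < c l n" using n(2) c_diff[of k n l] by simp
      ultimately show ?thesis by blast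
    qed
    show per_letter: "letter k = letter l" if dvd: "L dvd k - l" for k l
    proof -
      obtain z where "k - l = L * z" using dvd by blast
      then have "k = l + L * z" by simp
      then show ?thesis by (simp add: letter_def)
    qed
    show "\<exists>b. \<forall>k n. (\<forall>j<n. c k j = c (k + 1) j) \<longrightarrow> n \<le> b"
    proof -
      have "\<exists>f. \<forall>k. c k (f k) \<noteq> c (k + 1) (f k)"
        by (rule choice) (use lex in \<open>metis less_add_one less_irrefl\<close>)
      then obtain f where f: "\<And>k. c k (f k) \<noteq> c (k + 1) (f k)" by blast
      have "n \<le> Max (f ` {0..<L})" if agree: "\<And>j. j < n \<Longrightarrow> c k j = c (k + 1) j" for k n
      proof (rule ccontr)
        define l where "l = k mod L"
        have kl: "k = l + L * (k div L)" by (simp add: l_def)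
        have "l \<in> {0..<L}" using L by (simp add: l_def)
        then have "f l \<le> Max (f ` {0..<L})" by simp
        moreover assume "\<not> n \<le> Max (f ` {0..<L})"
        ultimately have "c k (f l) = c (k + 1) (f l)" using agree by simp
        moreover have "c (y + L * z) j = c y j + (if j = 0 then 2 * pi * of_int z else 0)" for y z j
          using HZ_per[of y z] per_letter[of "y + L * z" y] by (simp add: c_def algebra_simps)
        moreover have "k + 1 = (l + 1) + L * (k div L)" using kl by simp
        ultimately have "c l (f l) = c (l + 1) (f l)" using kl by (metis add_right_cancel)
        then show False using f by blast
      qed
      then show ?thesis by blast
    qed
    show "letter (mate k) = letter k" for k by (rule letter_mate)
    show "\<not> L dvd mate k - k" for k
    proof
      assume "L dvd mate k - k"
      then obtain z where "mate k - k = L * z" by blast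
      then have "mate k = k + L * z" by simp
      then have "H (mate k) = H k" using HZ_per by metis
      then show False using mate(1)[of k] H[of k] by (cases "H k") auto
    qed
    show "surj mate"
    proof (unfold surj_def, intro allI)
      fix j
      \<comment> \<open>The preimage of \<open>j\<close> is the other end, shifted back when \<open>mate\<close> would add a turn.\<close>
      define tb where "tb = (if odd (m (letter j)) \<and> snd (H j) then 1 else 0 :: int)"
      define j0 where "j0 = (SOME k. H k = (letter j, \<not> snd (H j)) \<and> Z k = Z j - tb)"
      have j0: "H j0 = (letter j, \<not> snd (H j))" "Z j0 = Z j - tb"
        using someI_ex[OF HZ_ex[of "(letter j, \<not> snd (H j))" "Z j - tb"]] by (auto simp: j0_def)
      have lp: "letter j0 = letter j" using H[of j0] j0 by simp
      have "mate j0 = j"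
        by (rule HZ_inj) (use mate[of j0] j0 lp H[of j] in \<open>auto simp: turn_def tb_def prod_eq_iff\<close>)
      then show "\<exists>k. j = mate k" by blast
    qed
    have N_dvd: "2 ^ e i dvd N i" for i unfolding e_def by (rule multiplicity_dvd)
    have mult_M: "multiplicity 2 M = multiplicity 2 (m i) + e i" for i
      using prime_elem_multiplicity_mult_distrib[of 2 "m i" "N i"] m[of i] N[of i] MN[of i]
      by (simp add: e_def)
    show "e i \<le> multiplicity 2 M" for i using mult_M[of i] by simp
    have odd_iff: "e i = multiplicity 2 M \<longleftrightarrow> odd (m i)" for i
      using mult_M[of i] m[of i] by (auto simp: multiplicity_eq_zero_iff)
    show "2 ^ e (letter k) dvd n" if "0 < n" "c k n \<noteq> 0" for n k
      using supp[OF that(1)] that N_dvd dvd_trans by (fastforce simp: c_def)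
    show "c (mate k) n = (-1) ^ (n div 2 ^ e (letter k)) * c k n" if n: "0 < n" for n k
    proof (cases "g (letter k) (snd (H k)) n = 0")
      case True
      then show ?thesis using n conj[OF n, of "letter k" "snd (H k)"] mate(1)[of k] letter_mate[of k]
        by (simp add: c_def)
    next
      case False
      then obtain t where t: "n = N (letter k) * t" using supp[OF n] by blast
      obtain y where y: "N (letter k) = 2 ^ e (letter k) * y" "odd y"
        using multiplicity_decompose'[of "N (letter k)" 2] N[of "letter k"] unfolding e_def by auto
      have "n div N (letter k) = t" using t N[of "letter k"] by simp
      moreover have "n div 2 ^ e (letter k) = y * t" using t y by (simp add: mult.assoc)
      ultimately have "(-1 :: real) ^ (n div N (letter k)) = (-1) ^ (n div 2 ^ e (letter k))"
        using y(2) by (simp add: minus_one_power_iff)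
      then show ?thesis using n conj[OF n, of "letter k" "snd (H k)"] mate(1)[of k] letter_mate[of k]
        by (simp add: c_def)
    qed
    show "c (mate k) 0 = c k 0 + (if e (letter k) = multiplicity 2 M then pi else 0)" for k
      using conj0[of "letter k"] mate[of k] letter_mate[of k] odd_iff[of "letter k"]
      by (cases "snd (H k)") (auto simp: c_def turn_def algebra_simps)
  qed
  have next_letter: "letter (k + 1) = w ! (Suc (nat (k mod L)) mod length w)" for k
  proof -
    define a where "a = nat (k mod L)"
    have "k mod L = int a" using L by (simp add: a_def)
    then have "(k + 1) mod L = int (Suc a) mod int (length w)"
      by (metis L_def mod_add_left_eq of_nat_Suc add.commute)
    then have "(k + 1) mod L = int (Suc a mod length w)" by (simp only: zmod_int)
    then show ?thesis by (simp only: letter_def a_def[symmetric] nat_int)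
  qed
  have in_range: "nat (k mod L) < length w" for k using L by (simp add: L_def nat_less_iff)
  show False
  proof (rule repeated_adjacency)
    show "letter k \<noteq> letter (k + 1)" for k
      unfolding next_letter using no_double[OF in_range] by (simp add: letter_def)
    show "L dvd k - l" if "{letter k, letter (k + 1)} = {letter l, letter (l + 1)}" for k l
    proof -
      have "nat (k mod L) = nat (l mod L)"
        using no_repeat in_range that unfolding next_letter unfolding letter_def by blast
      then have "k mod L = l mod L" using L by (simp add: eq_nat_nat_iff)
      then show ?thesis by (simp add: mod_eq_dvd_iff)
    qed
  qed
qed

instance branch_name :: finite
proof
  have "UNIV = {A, B, C, D, E}" by (auto intro: branch_name.exhaust)
  then show "finite (UNIV :: branch_name set)" by (rule ssubst) simp
qed

theorem mainTheorem1:
  shows "\<not> (\<exists>(F :: real poly poly) (p :: real \<times> real) (\<Gamma> :: branch_name \<Rightarrow> (real \<times> real) set).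
           F \<noteq> 0 \<and> eval2 F p = 0 \<and>
           germ_branches (zero_set F) p \<Gamma> \<and>
           (\<forall>\<^sub>F r in at_right 0. reads_cyclic_word \<Gamma> p r [A, E, B, A, C, B, D, C, E, D]))"
proof clarify
  fix F :: "real poly poly" and p :: "real \<times> real" and \<Gamma> :: "branch_name \<Rightarrow> (real \<times> real) set"
  define w where "w = [A, E, B, A, C, B, D, C, E, D]"
  define pair where "pair k = {w ! k, w ! (Suc k mod length w)}" for k
  assume germ: "germ_branches (zero_set F) p \<Gamma>"
    and "\<forall>\<^sub>F r in at_right 0. reads_cyclic_word \<Gamma> p r [A, E, B, A, C, B, D, C, E, D]"
  then have reads: "\<forall>\<^sub>F r in at_right 0. reads_cyclic_word \<Gamma> p r w" by (simp only: w_def)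
  have pairs: "map pair [0..<length w] =
      [{A, E}, {E, B}, {B, A}, {A, C}, {C, B}, {B, D}, {D, C}, {C, E}, {E, D}, {D, A}]"
    by (simp add: w_def pair_def upt_rec)
  then have "distinct (map pair [0..<length w])" by (simp add: doubleton_eq_iff)
  then have inj: "inj_on pair {..<length w}"
    by (simp only: distinct_map set_upt atLeast0LessThan)
  have nonempty: "w \<noteq> []" by (simp add: w_def)
  have no_double: "w ! k \<noteq> w ! (Suc k mod length w)" if "k < length w" for k
  proof
    assume "w ! k = w ! (Suc k mod length w)"
    then have "pair k = {w ! k}" by (simp add: pair_def)
    moreover have "pair k \<in> set (map pair [0..<length w])" using that by simp
    ultimately show False unfolding pairs by auto
  qed
  have "\<exists>k < length w. \<exists>l < length w. k \<noteq> l \<and> pair k = pair l"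
    unfolding pair_def by (rule analytic_word_repeats_adjacency[OF germ reads nonempty no_double])
  then show False using inj by (auto dest: inj_onD)
qed

end
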